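(* Let $n>2$ and let $B$ be an $n\times n$ level matrix, i.e. $B=L(T)$ for some rooted tree $T$ with $n$ vertices. Then $0$ is an eigenvalue of multiplicity $n-2$ of $B$ if and only if $B$ is associated with the rooted star $S_n$ (i.e. $T$ is isomorphic as a rooted tree to $S_n$).
   Context: A rooted tree is a finite tree with a distinguished vertex (the root). The level $l(v)$ of a vertex $v$ is its distance from the root. For a rooted tree $T$ with vertices $v_1,\dots,v_n$, the level matrix $L(T)=(l_{ij})$ is the $n\times n$ real symmetric matrix with $l_{ij}=|l(v_i)-l(v_j)|$. The rooted star $S_n$ is the $n$-vertex star whose root is the central vertex. *)

theory Defs
  imports
    "Graph_Theory.Graph_Theory"
    "Jordan_Normal_Form.Char_Poly"
begin

text \<open>
  Finite simple graphs are symmetric digraphs (\<^locale>\<open>pair_graph\<close>), so every edge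
  \<open>u\<close>--\<open>v\<close> yields the directed cycle \<open>u, v, u\<close> and the predicate
  \<open>Digraph_Component.tree\<close> fails for any such graph with an edge. The cycles of the
  underlying undirected graph are exactly the directed cycles with at least three arcs.
\<close>

definition undirected_tree :: "'a pair_pre_digraph \<Rightarrow> bool" where
  "undirected_tree G \<longleftrightarrow>
     pair_graph G \<and> Digraph_Component.connected (with_proj G) \<and>
     \<not> (\<exists>p. pre_digraph.cycle (with_proj G) p \<and> length p \<ge> 3)"

definition rooted_tree :: "'a pair_pre_digraph \<Rightarrow> 'a \<Rightarrow> bool" where
  "rooted_tree G r \<longleftrightarrow> undirected_tree G \<and> r \<in> pverts G"

definition level :: "'a pair_pre_digraph \<Rightarrow> 'a \<Rightarrow> 'a \<Rightarrow> nat" where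
  "level G r v = (LEAST k. \<exists>p. pre_digraph.awalk (with_proj G) r p v \<and> length p = k)"

text \<open>The list \<open>vs\<close> is the enumeration of the vertices that indexes rows and columns.\<close>

definition level_matrix :: "'a pair_pre_digraph \<Rightarrow> 'a \<Rightarrow> 'a list \<Rightarrow> real mat" where
  "level_matrix G r vs =
     mat (length vs) (length vs)
       (\<lambda>(i, j). \<bar>real (level G r (vs ! i)) - real (level G r (vs ! j))\<bar>)"

definition star_graph :: "nat \<Rightarrow> nat pair_pre_digraph" where
  "star_graph n = \<lparr> pverts = {0..<n}, parcs = {0} \<times> {1..<n} \<union> {1..<n} \<times> {0} \<rparr>"

definition rooted_iso ::
  "'a pair_pre_digraph \<Rightarrow> 'a \<Rightarrow> 'b pair_pre_digraph \<Rightarrow> 'b \<Rightarrow> bool" where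
  "rooted_iso G r H s \<longleftrightarrow>
     (\<exists>hom. pre_digraph.digraph_isomorphism (with_proj G) hom \<and>
            with_proj H = app_iso hom (with_proj G) \<and> iso_verts hom r = s)"

end

theory Submission
  imports Defs
begin

text \<open>
  The level matrix depends only on the list \<open>xs\<close> of levels: it is the matrix of pairwise distances
  of \<open>n\<close> points on the real line. Up to sign, the coefficient of \<open>X ^ (n - k)\<close> in its
  characteristic polynomial is the sum of the principal minors of size \<open>k\<close>, and each such minor
  is again the determinant of a distance matrix. For points on a line these minors are easy to control:

  \<^item> the one of two points at distance \<open>a\<close> is \<open>- a\<^sup>2\<close>;
  \<^item> the one of three points at distances \<open>a\<close>, \<open>b\<close>, \<open>c\<close> is \<open>2 a b c \<ge> 0\<close>,
    nonzero if the points are distinct;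
  \<^item> the one of more points than there are distinct values vanishes, having two equal rows.

  In each of the first two cases all terms have the same sign, so nothing cancels in the sum. If \<open>xs\<close>
  has exactly two distinct values, the coefficients below \<open>X ^ (n - 2)\<close> therefore vanish and that of
  \<open>X ^ (n - 2)\<close> does not, so \<open>0\<close> is a root of order exactly \<open>n - 2\<close>; with three distinct values the
  coefficient of \<open>X ^ (n - 3)\<close> is nonzero, and the order is smaller
  (\<open>order_char_poly_distance_matrix\<close>).

  It remains to see when a tree with more than two vertices has exactly two levels. A connected graph
  with a second vertex has vertices of levels \<open>0\<close> and \<open>1\<close>, so this happens exactly if every vertex
  other than the root is a neighbour of the root (\<open>card_levels_eq_2_iff\<close>). In the absence
  of cycles there is then no edge among the neighbours, since it would close a triangle with the root,
  and the tree is a star (\<open>rooted_iso_star_iff\<close>).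
\<close>

section \<open>Distance matrices of points on a line\<close>

definition distance_matrix :: "real list \<Rightarrow> real mat" where
  "distance_matrix xs = mat (length xs) (length xs) (\<lambda>(i, j). \<bar>xs ! i - xs ! j\<bar>)"

definition delete_nth :: "nat \<Rightarrow> 'a list \<Rightarrow> 'a list" where
  "delete_nth i xs = take i xs @ drop (Suc i) xs"

lemma length_delete_nth: "i < length xs \<Longrightarrow> length (delete_nth i xs) = length xs - 1"
  by (simp add: delete_nth_def)

lemma set_delete_nth: "set (delete_nth i xs) \<subseteq> set xs"
  by (auto simp: delete_nth_def dest: in_set_takeD in_set_dropD)

lemma distance_matrix_carrier: "distance_matrix xs \<in> carrier_mat (length xs) (length xs)"
  by (simp add: distance_matrix_def)

lemma mat_delete_distance_matrix:
  assumes "i < length xs"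
  shows "mat_delete (distance_matrix xs) i i = distance_matrix (delete_nth i xs)"
proof -
  have "delete_nth i xs ! j = xs ! (if j < i then j else Suc j)" if "j < length xs - 1" for j
    using assms that by (auto simp: delete_nth_def nth_append min_def)
  then show ?thesis
    by (intro eq_matI)
       (auto simp: mat_delete_def distance_matrix_def length_delete_nth[OF assms])
qed

text \<open>
  Comparing coefficients in the formula for the derivative of a characteristic polynomial gives a
  recursion that replaces the expansion of the coefficients into principal minors.
\<close>

lemma coeff_char_poly_distance_matrix_Suc:
  "real (Suc k) * coeff (char_poly (distance_matrix xs)) (Suc k) =
   (\<Sum>i<length xs. coeff (char_poly (distance_matrix (delete_nth i xs))) k)"
proof -
  have "real (Suc k) * coeff (char_poly (distance_matrix xs)) (Suc k) =
        coeff (pderiv (char_poly (distance_matrix xs))) k"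
    by (simp add: coeff_pderiv)
  also have "\<dots> = (\<Sum>i<length xs. coeff (char_poly (mat_delete (distance_matrix xs) i i)) k)"
    by (simp add: pderiv_char_poly[OF distance_matrix_carrier] coeff_sum)
  finally show ?thesis
    by (simp add: mat_delete_distance_matrix)
qed

lemma coeff_0_char_poly_distance_matrix:
  "coeff (char_poly (distance_matrix xs)) 0 = det (- distance_matrix xs)"
proof -
  have "char_matrix (distance_matrix xs) 0 = distance_matrix xs"
    by (rule eq_matI) (auto simp: char_matrix_def distance_matrix_def)
  then show ?thesis
    using char_poly_matrix[OF distance_matrix_carrier, of xs 0] by (simp add: poly_0_coeff_0)
qed

lemma det_2:
  fixes A :: "real mat"
  assumes "A \<in> carrier_mat 2 2"
  shows "det A = A $$ (0,0) * A $$ (1,1) - A $$ (0,1) * A $$ (1,0)"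
proof -
  have D: "mat_delete A i j \<in> carrier_mat 1 1" for i j
    using mat_delete_carrier[OF assms, of i j] by simp
  have "det A = (\<Sum>j<2. A $$ (0,j) * cofactor A 0 j)"
    by (rule laplace_expansion_row[OF assms]) simp
  also have "\<dots> = A $$ (0,0) * A $$ (1,1) - A $$ (0,1) * A $$ (1,0)"
    using assms by (simp add: eval_nat_numeral cofactor_def det_single[OF D]) (simp add: mat_delete_def)
  finally show ?thesis .
qed

lemma coeff_0_char_poly_distance_matrix_2:
  "coeff (char_poly (distance_matrix [x, y])) 0 = - (x - y)\<^sup>2"
proof -
  have C: "- distance_matrix [x, y] \<in> carrier_mat 2 2"
    using distance_matrix_carrier[of "[x, y]"] by (simp add: numeral_2_eq_2)
  have "det (- distance_matrix [x, y]) = - (\<bar>x - y\<bar> * \<bar>x - y\<bar>)"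
    by (simp add: det_2[OF C]) (simp add: distance_matrix_def abs_minus_commute)
  then show ?thesis
    by (simp add: coeff_0_char_poly_distance_matrix power2_eq_square)
qed

lemma coeff_0_char_poly_distance_matrix_3:
  "coeff (char_poly (distance_matrix [x, y, z])) 0 = - 2 * \<bar>x - y\<bar> * \<bar>y - z\<bar> * \<bar>x - z\<bar>"
proof -
  let ?A = "- distance_matrix [x, y, z]"
  have C: "?A \<in> carrier_mat 3 3"
    using distance_matrix_carrier[of "[x, y, z]"] by (simp add: numeral_3_eq_3)
  have D: "mat_delete ?A i j \<in> carrier_mat 2 2" for i j
    using mat_delete_carrier[OF C, of i j] by simp
  have "det ?A = (\<Sum>j<3. ?A $$ (0,j) * cofactor ?A 0 j)"
    by (rule laplace_expansion_row[OF C]) simp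
  also have "\<dots> = - 2 * \<bar>x - y\<bar> * \<bar>y - z\<bar> * \<bar>x - z\<bar>"
    by (simp add: eval_nat_numeral cofactor_def det_2[OF D])
       (simp add: mat_delete_def distance_matrix_def abs_minus_commute algebra_simps)
  finally show ?thesis
    by (simp add: coeff_0_char_poly_distance_matrix)
qed

section \<open>Low coefficients of the characteristic polynomial\<close>

text \<open>Two of the points coincide, so two rows are equal.\<close>

lemma coeff_0_char_poly_distance_matrix_repeated:
  assumes "\<not> distinct xs"
  shows "coeff (char_poly (distance_matrix xs)) 0 = 0"
proof -
  obtain i j where ij: "i < length xs" "j < length xs" "i \<noteq> j" "xs ! i = xs ! j"
    using assms by (auto simp: distinct_conv_nth)
  have "det (- distance_matrix xs) = 0"
    by (rule det_identical_rows[of _ "length xs" i j])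
       (use ij in \<open>auto simp: distance_matrix_def intro!: eq_vecI\<close>)
  then show ?thesis
    by (simp add: coeff_0_char_poly_distance_matrix)
qed

text \<open>
  Deleting points creates no new values, so after \<open>m\<close> deletions the recursion ends in lists that
  still have more points than values.
\<close>

lemma coeff_char_poly_distance_matrix_few_values:
  assumes "card (set xs) + m < length xs"
  shows "coeff (char_poly (distance_matrix xs)) m = 0"
  using assms
proof (induction m arbitrary: xs)
  case 0
  then show ?case
    by (intro coeff_0_char_poly_distance_matrix_repeated) (auto simp: distinct_card)
next
  case (Suc m)
  have "coeff (char_poly (distance_matrix (delete_nth i xs))) m = 0" if "i < length xs" for i
  proof -
    have "card (set (delete_nth i xs)) \<le> card (set xs)"
      by (simp add: card_mono set_delete_nth)
    then show ?thesis
      using Suc that by (simp add: length_delete_nth)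
  qed
  then show ?case
    using coeff_char_poly_distance_matrix_Suc[of m xs] by simp
qed

text \<open>
  If some value is repeated, one of its copies can go; otherwise there are more than \<open>k\<close> values and
  any point can go.
\<close>

lemma delete_nth_keep_values:
  assumes "k < length xs" "k \<le> card (set xs)"
  shows "\<exists>i<length xs. k \<le> card (set (delete_nth i xs))"
proof (cases "distinct xs")
  case True
  then have "distinct (delete_nth 0 xs)"
    by (simp add: delete_nth_def)
  then have "card (set (delete_nth 0 xs)) = length xs - 1"
    using assms(1) length_delete_nth[of 0 xs] by (cases xs) (simp_all add: distinct_card)
  then show ?thesis
    using assms by (intro exI[of _ 0]) auto
next
  case False
  then obtain ys y zs ws where xs: "xs = ys @ [y] @ zs @ [y] @ ws"
    using not_distinct_decomp by blast
  then have "set (delete_nth (length ys) xs) = set xs"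
    by (auto simp: delete_nth_def)
  then show ?thesis
    using assms xs by (intro exI[of _ "length ys"]) auto
qed

text \<open>
  If no determinant over \<open>k\<close> points has the wrong sign, a single set of \<open>k\<close> distinct points among
  those of \<open>xs\<close> suffices to make the whole sum nonzero: by \<open>delete_nth_keep_values\<close> the
  induction can always remove a point so that \<open>k\<close> distinct ones survive.
\<close>

lemma coeff_char_poly_distance_matrix_neg:
  assumes nonpos: "\<And>ys. length ys = k \<Longrightarrow> coeff (char_poly (distance_matrix ys)) 0 \<le> 0"
    and neg: "\<And>ys. length ys = k \<Longrightarrow> distinct ys \<Longrightarrow> coeff (char_poly (distance_matrix ys)) 0 < 0"
    and "length xs = m + k"
  shows "coeff (char_poly (distance_matrix xs)) m \<le> 0 \<and>
         (k \<le> card (set xs) \<longrightarrow> coeff (char_poly (distance_matrix xs)) m < 0)"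
  using assms(3)
proof (induction m arbitrary: xs)
  case 0
  have "distinct xs" if "k \<le> card (set xs)"
    using that 0 card_length[of xs] by (intro card_distinct) simp
  then show ?case
    using 0 nonpos neg by auto
next
  case (Suc m)
  let ?c = "\<lambda>i. coeff (char_poly (distance_matrix (delete_nth i xs))) m"
  have IH: "?c i \<le> 0 \<and> (k \<le> card (set (delete_nth i xs)) \<longrightarrow> ?c i < 0)" if "i < length xs" for i
    using Suc that by (simp add: length_delete_nth)
  have rec: "real (Suc m) * coeff (char_poly (distance_matrix xs)) (Suc m) = (\<Sum>i<length xs. ?c i)"
    by (rule coeff_char_poly_distance_matrix_Suc)
  have "(\<Sum>i<length xs. ?c i) \<le> 0"
    by (rule sum_nonpos) (use IH in auto)
  then have "coeff (char_poly (distance_matrix xs)) (Suc m) \<le> 0"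
    using rec by (metis mult_le_0_iff of_nat_0_less_iff zero_less_Suc not_less)
  moreover have "coeff (char_poly (distance_matrix xs)) (Suc m) < 0" if "k \<le> card (set xs)"
  proof -
    have "k < length xs"
      using Suc.prems by simp
    then obtain i where i: "i < length xs" "k \<le> card (set (delete_nth i xs))"
      using delete_nth_keep_values \<open>k \<le> card (set xs)\<close> by blast
    have "(\<Sum>i<length xs. ?c i) < (\<Sum>i<length xs. 0)"
      by (rule sum_strict_mono_ex1) (use IH i in auto)
    then show ?thesis
      using rec by (metis mult_less_0_iff of_nat_0_less_iff zero_less_Suc not_less_iff_gr_or_eq sum.neutral_const)
  qed
  ultimately show ?case by blast
qed

lemma coeff_char_poly_distance_matrix_two_values:
  assumes "length xs = m + 2" "2 \<le> card (set xs)"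
  shows "coeff (char_poly (distance_matrix xs)) m < 0"
proof -
  have "coeff (char_poly (distance_matrix ys)) 0 \<le> 0 \<and>
        (distinct ys \<longrightarrow> coeff (char_poly (distance_matrix ys)) 0 < 0)"
    if "length ys = 2" for ys
  proof -
    obtain x y where "ys = [x, y]"
      using \<open>length ys = 2\<close> by (auto simp: numeral_2_eq_2 length_Suc_conv)
    then show ?thesis
      by (simp add: coeff_0_char_poly_distance_matrix_2)
  qed
  then show ?thesis
    using coeff_char_poly_distance_matrix_neg[of 2 xs m] assms by blast
qed

lemma coeff_char_poly_distance_matrix_three_values:
  assumes "length xs = m + 3" "3 \<le> card (set xs)"
  shows "coeff (char_poly (distance_matrix xs)) m < 0"
proof -
  have "coeff (char_poly (distance_matrix ys)) 0 \<le> 0 \<and>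
        (distinct ys \<longrightarrow> coeff (char_poly (distance_matrix ys)) 0 < 0)"
    if "length ys = 3" for ys
  proof -
    obtain x y z where "ys = [x, y, z]"
      using \<open>length ys = 3\<close> by (auto simp: numeral_3_eq_3 length_Suc_conv)
    then show ?thesis
      by (simp add: coeff_0_char_poly_distance_matrix_3)
  qed
  then show ?thesis
    using coeff_char_poly_distance_matrix_neg[of 3 xs m] assms by blast
qed

theorem order_char_poly_distance_matrix:
  assumes "2 \<le> card (set xs)"
  shows "order 0 (char_poly (distance_matrix xs)) = length xs - 2 \<longleftrightarrow> card (set xs) = 2"
proof -
  let ?p = "char_poly (distance_matrix xs)"
  have len: "card (set xs) \<le> length xs"
    by (rule card_length)
  have "?p \<noteq> 0"
    using degree_monic_char_poly[OF distance_matrix_carrier, of xs] by auto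
  then have order: "m \<le> order 0 ?p \<longleftrightarrow> (\<forall>k<m. coeff ?p k = 0)" for m
    by (simp add: monom_1_dvd_iff'[symmetric] monom_1_dvd_iff)
  show ?thesis
  proof
    assume two: "card (set xs) = 2"
    have "length xs - 2 \<le> order 0 ?p"
      using two by (auto simp: order intro!: coeff_char_poly_distance_matrix_few_values)
    moreover have "coeff ?p (length xs - 2) \<noteq> 0"
      using coeff_char_poly_distance_matrix_two_values[of xs "length xs - 2"] two len
      by (metis le_add_diff_inverse2 less_irrefl order.refl)
    then have "\<not> Suc (length xs - 2) \<le> order 0 ?p"
      unfolding order by blast
    ultimately show "order 0 ?p = length xs - 2" by simp
  next
    assume ord: "order 0 ?p = length xs - 2"
    show "card (set xs) = 2"
    proof (rule ccontr)
      assume "card (set xs) \<noteq> 2"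
      then have three: "3 \<le> card (set xs)" using assms by simp
      have "coeff ?p (length xs - 3) \<noteq> 0"
        using coeff_char_poly_distance_matrix_three_values[of xs "length xs - 3"] three len by simp
      moreover have "coeff ?p (length xs - 3) = 0"
        using order[of "length xs - 2"] ord three len by simp
      ultimately show False by blast
    qed
  qed
qed

section \<open>Rooted trees with two levels\<close>

lemma shortest_awalk_from_root:
  assumes "undirected_tree T" "r \<in> pverts T" "v \<in> pverts T"
  obtains p where "pre_digraph.awalk (with_proj T) r p v" "length p = level T r v"
proof -
  interpret pair_graph T using assms by (simp add: undirected_tree_def)
  have "strongly_connected (with_proj T)"
    using assms by (intro symmetric_connected_imp_strongly_connected)
      (auto simp: undirected_tree_def pair_sym_arcs)
  then have "r \<rightarrow>\<^sup>*\<^bsub>with_proj T\<^esub> v"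
    using assms by (auto simp: strongly_connected_def)
  then have "\<exists>k p. awalk r p v \<and> length p = k"
    by (auto simp: reachable_awalk)
  then have "\<exists>p. awalk r p v \<and> length p = level T r v"
    unfolding level_def by (rule LeastI_ex)
  then show ?thesis using that by blast
qed

lemma level_le_length:
  assumes "pre_digraph.awalk (with_proj T) r p v"
  shows "level T r v \<le> length p"
  unfolding level_def using assms by (auto intro: Least_le)

lemma level_root: "r \<in> pverts T \<Longrightarrow> level T r r = 0"
  using level_le_length[of T r "[]" r] by (simp add: pre_digraph.awalk_def pre_digraph.cas.simps)

lemma level_eq_0_iff:
  assumes "undirected_tree T" "r \<in> pverts T" "v \<in> pverts T"
  shows "level T r v = 0 \<longleftrightarrow> v = r"
proof
  assume "level T r v = 0"
  with shortest_awalk_from_root[OF assms] show "v = r"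
    by (metis length_0_conv pre_digraph.awalk_def pre_digraph.cas.simps(1))
qed (use assms level_root in auto)

lemma level_eq_1_iff:
  assumes "undirected_tree T" "r \<in> pverts T" "v \<in> pverts T"
  shows "level T r v = 1 \<longleftrightarrow> (r, v) \<in> parcs T"
proof -
  interpret pair_graph T using assms by (simp add: undirected_tree_def)
  show ?thesis
  proof
    assume "level T r v = 1"
    then obtain p where "awalk r p v" "length p = 1"
      using shortest_awalk_from_root[OF assms] by metis
    then show "(r, v) \<in> parcs T"
      by (auto simp: length_Suc_conv awalk_Cons_iff awalk_Nil_iff)
  next
    assume arc: "(r, v) \<in> parcs T"
    then have "awalk r [(r, v)] v"
      using assms by (simp add: awalk_Cons_iff awalk_Nil_iff)
    then have "level T r v \<le> 1"
      using level_le_length[of T r "[(r, v)]" v] by simp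
    moreover have "v \<noteq> r"
      using arc no_loops' by blast
    ultimately show "level T r v = 1"
      using level_eq_0_iff[OF assms] by simp
  qed
qed

text \<open>The first arc of any walk that leaves the root leads to a vertex of level \<open>1\<close>.\<close>

lemma exists_level_1:
  assumes "undirected_tree T" "r \<in> pverts T" "1 < card (pverts T)"
  shows "\<exists>w \<in> pverts T. level T r w = 1"
proof -
  interpret pair_graph T using assms by (simp add: undirected_tree_def)
  obtain v where v: "v \<in> pverts T" "v \<noteq> r"
    using assms(3) by (metis card_le_Suc0_iff_eq pair_finite_verts assms(2) not_less One_nat_def)
  obtain p where p: "awalk r p v"
    using shortest_awalk_from_root[OF assms(1,2) v(1)] by metis
  with v obtain e q where "p = e # q"
    by (cases p) (auto simp: awalk_Nil_iff)
  with p have e: "(r, snd e) \<in> parcs T"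
    by (cases e) (auto simp: awalk_Cons_iff)
  then show ?thesis
    using level_eq_1_iff[OF assms(1,2)] in_arcsD2 by blast
qed

lemma
  assumes "undirected_tree T" "r \<in> pverts T" "1 < card (pverts T)"
  shows card_levels_ge_2: "2 \<le> card (level T r ` pverts T)"
    and card_levels_eq_2_iff:
      "card (level T r ` pverts T) = 2 \<longleftrightarrow> (\<forall>v \<in> pverts T - {r}. (r, v) \<in> parcs T)"
proof -
  let ?L = "level T r ` pverts T"
  interpret pair_graph T using assms by (simp add: undirected_tree_def)
  have "0 \<in> ?L"
    using level_root[OF assms(2)] assms(2) by (metis image_eqI)
  moreover have "1 \<in> ?L"
    using exists_level_1[OF assms] by (metis image_eqI)
  ultimately have sub: "{0, 1} \<subseteq> ?L" by blast
  have fin: "finite ?L" using pair_finite_verts by simp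
  show "2 \<le> card ?L"
    using card_mono[OF fin sub] by simp
  have "card ?L = 2 \<longleftrightarrow> ?L = {0, 1}"
  proof
    assume "card ?L = 2"
    then show "?L = {0, 1}"
      using card_subset_eq[OF fin sub] by simp
  qed simp
  also have "\<dots> \<longleftrightarrow> ?L \<subseteq> {0, 1}"
    using sub by (metis order.refl subset_antisym)
  also have "\<dots> \<longleftrightarrow> (\<forall>v \<in> pverts T. level T r v = 0 \<or> level T r v = 1)"
    by (simp add: image_subset_iff)
  also have "\<dots> \<longleftrightarrow> (\<forall>v \<in> pverts T - {r}. (r, v) \<in> parcs T)"
    using level_eq_0_iff[OF assms(1,2)] level_eq_1_iff[OF assms(1,2)] by auto
  finally show "card ?L = 2 \<longleftrightarrow> (\<forall>v \<in> pverts T - {r}. (r, v) \<in> parcs T)" .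
qed

section \<open>Trees isomorphic to the rooted star\<close>

text \<open>An arc between two neighbours \<open>u\<close>, \<open>v\<close> of the root would close the cycle \<open>r, u, v, r\<close>.\<close>

lemma parcs_eq_star:
  assumes "undirected_tree T" "r \<in> pverts T"
    and adj: "\<forall>v \<in> pverts T - {r}. (r, v) \<in> parcs T"
  shows "parcs T = {r} \<times> (pverts T - {r}) \<union> (pverts T - {r}) \<times> {r}"
proof -
  interpret pair_graph T using assms by (simp add: undirected_tree_def)
  have adj': "(v, r) \<in> parcs T" if "v \<in> pverts T - {r}" for v
    using pair_sym_arcs adj that by (auto simp: symmetric_def elim: symE)
  have star: "u = r \<or> v = r" if uv: "(u, v) \<in> parcs T" for u v
  proof (rule ccontr)
    assume ne: "\<not> (u = r \<or> v = r)"
    have u: "u \<in> pverts T" and v: "v \<in> pverts T" and "u \<noteq> v"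
      using uv in_arcsD1 in_arcsD2 no_loops' by auto
    let ?p = "[(r, u), (u, v), (v, r)]"
    have "awalk r ?p r"
      using adj adj' u v uv ne assms(2) by (simp add: awalk_Cons_iff awalk_Nil_iff)
    then have "cycle ?p"
      using ne \<open>u \<noteq> v\<close> by (auto simp: cycle_def intro!: exI[of _ r])
    then show False
      using assms(1) by (auto simp: undirected_tree_def dest: spec[of _ ?p])
  qed
  show ?thesis
  proof (intro Set.set_eqI iffI)
    fix a assume "a \<in> parcs T"
    then show "a \<in> {r} \<times> (pverts T - {r}) \<union> (pverts T - {r}) \<times> {r}"
      using star[of "fst a" "snd a"] in_arcsD1[of "fst a" "snd a"] in_arcsD2[of "fst a" "snd a"]
        no_loops'[of "fst a" "snd a"]
      by (cases a) auto
  qed (use adj adj' in auto)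
qed

text \<open>
  The arc of the star from \<open>0\<close> to the image of \<open>v\<close> is the image of an arc of \<open>T\<close>, and by
  injectivity on vertices that arc joins \<open>r\<close> to \<open>v\<close>.
\<close>

lemma rooted_iso_star_imp_adjacent:
  assumes "rooted_iso T r (star_graph n) 0" "r \<in> pverts T" "v \<in> pverts T" "v \<noteq> r"
  shows "(r, v) \<in> parcs T"
proof -
  obtain hom where hom: "pre_digraph.digraph_isomorphism (with_proj T) hom"
    and eq: "with_proj (star_graph n) = app_iso hom (with_proj T)" and root: "iso_verts hom r = 0"
    using assms(1) by (auto simp: rooted_iso_def)
  have tail: "iso_tail hom = fst" and head: "iso_head hom = snd"
    and verts: "iso_verts hom ` pverts T = {0..<n}"
    and arcs: "iso_arcs hom ` parcs T = parcs (star_graph n)"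
    using arg_cong[OF eq, of pre_digraph.tail] arg_cong[OF eq, of pre_digraph.head]
      arg_cong[OF eq, of verts] arg_cong[OF eq, of pre_digraph.arcs]
    by (simp_all add: star_graph_def)
  have wf: "pair_wf_digraph T" and inj: "inj_on (iso_verts hom) (pverts T)"
    using hom by (simp_all add: pre_digraph.digraph_isomorphism_def wf_digraph_wp_iff)
  have "iso_verts hom v \<in> {0..<n}"
    using assms verts by blast
  moreover have "iso_verts hom v \<noteq> 0"
    using inj_onD[OF inj, of v r] assms root by auto
  ultimately have "(0, iso_verts hom v) \<in> parcs (star_graph n)"
    by (auto simp: star_graph_def)
  then obtain a where a: "a \<in> parcs T" "iso_arcs hom a = (0, iso_verts hom v)"
    using arcs by (metis imageE)
  have "iso_verts hom (fst a) = iso_verts hom r" "iso_verts hom (snd a) = iso_verts hom v"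
    using hom a tail head root by (auto simp: pre_digraph.digraph_isomorphism_def)
  then have "a = (r, v)"
    using inj a assms pair_wf_digraph.arc_fst_in_verts[OF wf] pair_wf_digraph.arc_snd_in_verts[OF wf]
    by (metis inj_onD prod.collapse)
  then show ?thesis using a by simp
qed

text \<open>Any bijection of the vertices onto \<open>{0..<n}\<close> that sends the root to \<open>0\<close> is an isomorphism.\<close>

lemma rooted_iso_starI:
  assumes "undirected_tree T" "r \<in> pverts T"
    and adj: "\<forall>v \<in> pverts T - {r}. (r, v) \<in> parcs T"
  shows "rooted_iso T r (star_graph (card (pverts T))) 0"
proof -
  interpret pair_graph T using assms by (simp add: undirected_tree_def)
  define n where "n = card (pverts T)"
  let ?W = "pverts T - {r}"
  have "card ?W = card {1..<n}"
    using assms(2) pair_finite_verts by (simp add: n_def)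
  then obtain g where g: "bij_betw g ?W {1..<n}"
    using finite_same_card_bij[of ?W "{1..<n}"] pair_finite_verts by auto
  define f where "f = g(r := 0)"
  have f_W: "f ` ?W = {1..<n}"
    using g by (auto simp: f_def bij_betw_def)
  have pos: "0 < n"
    using assms(2) pair_finite_verts by (auto simp: n_def card_gt_0_iff)
  have verts_eq: "pverts T = insert r ?W"
    using assms(2) by blast
  have f_verts: "f ` pverts T = {0..<n}"
  proof -
    have "f ` pverts T = insert (f r) (f ` ?W)"
      using verts_eq by (metis image_insert)
    also have "\<dots> = {0..<n}"
      using pos by (auto simp: f_W) (simp_all add: f_def)
    finally show ?thesis .
  qed
  then have inj: "inj_on f (pverts T)"
    by (intro eq_card_imp_inj_on) (simp_all add: pair_finite_verts n_def)
  have arcs: "map_prod f f ` parcs T = parcs (star_graph n)"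
  proof -
    have "map_prod f f ` parcs T = {f r} \<times> f ` ?W \<union> f ` ?W \<times> {f r}"
      unfolding parcs_eq_star[OF assms] image_Un by (force simp: image_iff)
    also have "f r = 0" by (simp add: f_def)
    finally show ?thesis by (simp add: f_W star_graph_def)
  qed
  have inj_arcs: "inj_on (map_prod f f) (parcs T)"
    by (rule inj_on_subset[OF map_prod_inj_on[OF inj inj]]) (auto dest: in_arcsD1 in_arcsD2)
  let ?hom = "\<lparr>iso_verts = f, iso_arcs = map_prod f f, iso_head = snd, iso_tail = fst\<rparr>"
  have "digraph_isomorphism ?hom"
    unfolding digraph_isomorphism_def using inj inj_arcs by (auto simp: wf_digraph_axioms)
  moreover have "with_proj (star_graph n) = app_iso ?hom (with_proj T)"
    using arcs f_verts by (simp add: app_iso_def with_proj_def star_graph_def)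
  moreover have "iso_verts ?hom r = 0"
    by (simp add: f_def)
  ultimately show ?thesis
    unfolding rooted_iso_def n_def by blast
qed

lemma rooted_iso_star_iff:
  assumes "undirected_tree T" "r \<in> pverts T"
  shows "rooted_iso T r (star_graph (card (pverts T))) 0 \<longleftrightarrow>
         (\<forall>v \<in> pverts T - {r}. (r, v) \<in> parcs T)"
proof
  assume "rooted_iso T r (star_graph (card (pverts T))) 0"
  from rooted_iso_star_imp_adjacent[OF this assms(2)]
  show "\<forall>v \<in> pverts T - {r}. (r, v) \<in> parcs T" by simp
qed (rule rooted_iso_starI[OF assms])

section \<open>The multiplicity of zero in the level matrix\<close>

lemma level_matrix_eq_distance_matrix:
  "level_matrix T r vs = distance_matrix (map (\<lambda>v. real (level T r v)) vs)"
  by (rule eq_matI) (auto simp: level_matrix_def distance_matrix_def)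

theorem theorem11:
  fixes T :: "'a pair_pre_digraph" and r :: 'a and vs :: "'a list"
    and n :: nat and B :: "real mat"
  assumes "n > 2"
    and "rooted_tree T r"
    and "distinct vs" and "set vs = pverts T" and "length vs = n"
    and "B = level_matrix T r vs"
  shows "(eigenvalue B 0 \<and> order 0 (char_poly B) = n - 2) \<longleftrightarrow> rooted_iso T r (star_graph n) 0"
proof -
  have T: "undirected_tree T" and r: "r \<in> pverts T"
    using assms(2) by (auto simp: rooted_tree_def)
  have n: "card (pverts T) = n"
    using assms(3-5) distinct_card by metis
  define xs where "xs = map (\<lambda>v. real (level T r v)) vs"
  have B: "B = distance_matrix xs"
    using assms(6) by (simp add: xs_def level_matrix_eq_distance_matrix)
  have "set xs = real ` level T r ` pverts T"
    using assms(4) by (simp add: xs_def image_image)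
  then have card: "card (set xs) = card (level T r ` pverts T)"
    by (simp add: card_image)
  have ne: "char_poly B \<noteq> 0"
    using degree_monic_char_poly[OF distance_matrix_carrier, of xs] by (auto simp: B)
  have "eigenvalue B 0" if "order 0 (char_poly B) = n - 2"
    using that assms(1) ne order_root[of "char_poly B" 0]
    by (simp add: B eigenvalue_root_char_poly[OF distance_matrix_carrier])
  then have "(eigenvalue B 0 \<and> order 0 (char_poly B) = n - 2) \<longleftrightarrow> order 0 (char_poly B) = length xs - 2"
    using assms(5) by (auto simp: xs_def)
  also have "\<dots> \<longleftrightarrow> card (level T r ` pverts T) = 2"
    using order_char_poly_distance_matrix[of xs] card_levels_ge_2[OF T r] assms(1) n
    by (simp add: B card)
  also have "\<dots> \<longleftrightarrow> rooted_iso T r (star_graph n) 0"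
    using card_levels_eq_2_iff[OF T r] rooted_iso_star_iff[OF T r] assms(1) n by simp
  finally show ?thesis .
qed

end
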